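(* Let $n\ge 3$ and let $H$ be a 1-ordering of the path $P_n$ on $n$ vertices. Then $R_<(H)\le R(C_n)$, where $C_n$ is the $n$-cycle and $R(C_n)$ is its (unordered) two-color Ramsey number.
   Context: A $k$-ordering of a graph $H$ assigns distinct order-labels from $\{1,\ldots,|H|\}$ to $k$ of the vertices of $H$; a 1-ordering labels exactly one vertex. An ordered 2-coloring on $m$ vertices is a red/blue coloring of the edges of the complete graph on vertex set $\{1,\ldots,m\}$. It contains a $k$-ordering $H$ (in a given color) if it has a subgraph isomorphic to $H$, all of whose edges have that color, such that for every $i$ the $i$-th smallest vertex of the copy corresponds to a vertex of $H$ that has order-label $i$ or no order-label. $R_<(H)$ is the least $m$ such that every ordered 2-coloring on $m$ vertices contains a monochromatic copy of $H$. $R(C_n)$ is the least $m$ such that every red/blue coloring of the edges of $K_m$ contains a monochromatic copy of $C_n$. *)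

theory Defs
  imports Main
begin

type_synonym 'a graph = "'a set \<times> 'a set set"  \<comment> \<open>vertices, edges as 2-element sets\<close>

abbreviation verts :: "'a graph \<Rightarrow> 'a set" where "verts \<equiv> fst"
abbreviation edges :: "'a graph \<Rightarrow> 'a set set" where "edges \<equiv> snd"

definition path_graph :: "nat \<Rightarrow> nat graph" where
  "path_graph n = ({1..n}, {{i, i + 1} | i. 1 \<le> i \<and> i < n})"

text \<open>For \<open>n \<ge> 3\<close> this is the \<open>n\<close>-cycle; smaller \<open>n\<close> are degenerate.\<close>

definition cycle_graph :: "nat \<Rightarrow> nat graph" where
  "cycle_graph n = ({1..n}, {{i, i + 1} | i. 1 \<le> i \<and> i < n} \<union> {{n, 1}})"

text \<open>A \<open>k\<close>-ordering of \<open>G\<close> is given by its partial labelling \<open>L\<close>: \<open>L v = Some i\<close> if \<open>v\<close> has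
  order-label \<open>i\<close>, and \<open>L v = None\<close> if \<open>v\<close> has no order-label.\<close>

definition is_ordering :: "nat \<Rightarrow> 'a graph \<Rightarrow> ('a \<rightharpoonup> nat) \<Rightarrow> bool" where
  "is_ordering k G L \<longleftrightarrow>
     dom L \<subseteq> verts G \<and> card (dom L) = k \<and> inj_on L (dom L) \<and> ran L \<subseteq> {1..card (verts G)}"

datatype colour = Red | Blue

text \<open>A 2-colouring of the complete graph on \<open>{1..m}\<close> is a function \<open>\<chi> :: nat set \<Rightarrow> colour\<close>, of which
  only the values on the 2-element subsets of \<open>{1..m}\<close> matter. A copy of \<open>G\<close> (a not necessarily
  induced subgraph isomorphic to \<open>G\<close>) is given by an injection \<open>f\<close> of the vertices.\<close>

definition is_mono_copy ::
  "nat \<Rightarrow> (nat set \<Rightarrow> colour) \<Rightarrow> colour \<Rightarrow> 'a graph \<Rightarrow> ('a \<Rightarrow> nat) \<Rightarrow> bool" where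
  "is_mono_copy m \<chi> c G f \<longleftrightarrow>
     inj_on f (verts G) \<and> f ` verts G \<subseteq> {1..m} \<and> (\<forall>e\<in>edges G. \<chi> (f ` e) = c)"

definition is_ith_smallest :: "nat set \<Rightarrow> nat \<Rightarrow> nat \<Rightarrow> bool" where
  "is_ith_smallest S i x \<longleftrightarrow> x \<in> S \<and> card {y \<in> S. y \<le> x} = i"

definition respects_ordering :: "'a graph \<Rightarrow> ('a \<rightharpoonup> nat) \<Rightarrow> ('a \<Rightarrow> nat) \<Rightarrow> bool" where
  "respects_ordering G L f \<longleftrightarrow>
     (\<forall>i\<in>{1..card (verts G)}. \<forall>v\<in>verts G.
        is_ith_smallest (f ` verts G) i (f v) \<longrightarrow> L v = Some i \<or> L v = None)"

text \<open>By Ramsey's theorem both minima below are over nonempty sets for every finite \<open>G\<close>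
  (and every ordering \<open>L\<close> of it).\<close>

definition ramsey_number :: "'a graph \<Rightarrow> nat" where
  "ramsey_number G = (LEAST m. \<forall>\<chi>. \<exists>c f. is_mono_copy m \<chi> c G f)"

definition ordered_ramsey_number :: "'a graph \<Rightarrow> ('a \<rightharpoonup> nat) \<Rightarrow> nat" where
  "ordered_ramsey_number G L =
     (LEAST m. \<forall>\<chi>. \<exists>c f. is_mono_copy m \<chi> c G f \<and> respects_ordering G L f)"

end

(* A monochromatic cycle contains n monochromatic Hamiltonian paths, one for every rotation of the
   cycle, so the unique labelled vertex of the path can be placed at any prescribed vertex of the
   cycle, in particular at the one whose rank is the label. Ramsey's theorem is needed only to know
   that R(C_n) is attained. *)

theory Submission
  imports Defs "HOL-Library.Ramsey"
begin

text \<open>The rank in \<open>S\<close> is strictly increasing along \<open>S\<close>, hence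
  injective into \<open>{1..card S}\<close>; by counting it hits every value there.\<close>

lemma ex_is_ith_smallest:
  assumes "finite S" "i \<in> {1..card S}"
  obtains x where "is_ith_smallest S i x"
proof -
  let ?rank = "\<lambda>x. card {y \<in> S. y \<le> x}"
  have "?rank x < ?rank y" if "x \<in> S" "y \<in> S" "x < y" for x y
  proof (rule psubset_card_mono)
    have "{z \<in> S. z \<le> x} \<subseteq> {z \<in> S. z \<le> y}" "y \<in> {z \<in> S. z \<le> y} - {z \<in> S. z \<le> x}"
      using that by auto
    then show "{z \<in> S. z \<le> x} \<subset> {z \<in> S. z \<le> y}"
      by blast
  qed (use \<open>finite S\<close> in auto)
  then have "inj_on ?rank S"
    by (intro linorder_inj_onI) (auto simp: less_imp_neq)
  moreover have "?rank ` S \<subseteq> {1..card S}"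
    using \<open>finite S\<close> by (auto simp: Suc_le_eq card_gt_0_iff intro!: card_mono)
  ultimately have "?rank ` S = {1..card S}"
    by (simp add: card_image card_subset_eq)
  then obtain x where "x \<in> S" "?rank x = i"
    using assms(2) by (metis (no_types, lifting) imageE)
  then show ?thesis
    using that by (auto simp: is_ith_smallest_def)
qed

text \<open>In a homogeneous set with as many elements as \<open>G\<close> has vertices, every
  bijection from the vertices gives a copy. The assumption on edges excludes loops, whose images
  would be singletons, where homogeneity says nothing about \<open>\<chi>\<close>.\<close>

lemma ex_mono_copy:
  assumes "finite (verts G)"
    and edges: "\<And>e. e \<in> edges G \<Longrightarrow> \<exists>u\<in>verts G. \<exists>v\<in>verts G. u \<noteq> v \<and> e = {u, v}"
  shows "\<exists>m. \<forall>\<chi>. \<exists>c f. is_mono_copy m \<chi> c G f"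
proof -
  let ?k = "card (verts G)"
  obtain m where m: "\<forall>(V::nat set) E. finite V \<and> card V \<ge> m \<longrightarrow>
      (\<exists>R \<subseteq> V. card R = ?k \<and> clique R E \<or> card R = ?k \<and> indep R E)"
    using ramsey2[where 'a = nat, of ?k ?k] by blast
  have "\<exists>c f. is_mono_copy m \<chi> c G f" for \<chi>
  proof -
    \<comment> \<open>The red pairs are taken as the edges of a graph, so a clique is all red and an
      independent set all blue.\<close>
    obtain R where R: "R \<subseteq> {1..m}" "card R = ?k"
      and hom: "clique R {e. \<chi> e = Red} \<or> indep R {e. \<chi> e = Red}"
      using m[rule_format, of "{1..m}" "{e. \<chi> e = Red}"] by auto
    have "(\<forall>u\<in>R. \<forall>v\<in>R. u \<noteq> v \<longrightarrow> \<chi> {u, v} = Red) \<or> (\<forall>u\<in>R. \<forall>v\<in>R. u \<noteq> v \<longrightarrow> \<chi> {u, v} = Blue)"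
      using hom by (simp add: clique_def indep_def) (meson colour.exhaust)
    then obtain c where c: "\<And>u v. \<lbrakk>u \<in> R; v \<in> R; u \<noteq> v\<rbrakk> \<Longrightarrow> \<chi> {u, v} = c"
      by blast
    obtain f where f: "bij_betw f (verts G) R"
      using R assms(1) by (metis finite_atLeastAtMost finite_same_card_bij finite_subset)
    have "\<chi> (f ` e) = c" if "e \<in> edges G" for e
    proof -
      obtain u v where "u \<in> verts G" "v \<in> verts G" "u \<noteq> v" "e = {u, v}"
        using edges[OF \<open>e \<in> edges G\<close>] by blast
      then show ?thesis
        using c f by (simp add: bij_betw_apply inj_on_eq_iff[OF bij_betw_imp_inj_on])
    qed
    then have "is_mono_copy m \<chi> c G f"
      using f R(1) by (auto simp: is_mono_copy_def bij_betw_def)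
    then show ?thesis by blast
  qed
  then show ?thesis by blast
qed

text \<open>The path is the cycle without its closing edge \<open>{n, 1}\<close>. A rotation
  preserves cyclic adjacency, so it carries path edges to cycle edges, and its shift can be chosen
  to send \<open>v\<close> to \<open>j\<close>.\<close>

lemma cycle_graph_rotation:
  assumes "j \<in> {1..n}" "v \<in> {1..n}"
  obtains r where "bij_betw r {1..n} {1..n}" "r v = j"
    "\<And>e. e \<in> edges (path_graph n) \<Longrightarrow> r ` e \<in> edges (cycle_graph n)"
proof -
  \<comment> \<open>The shift is \<open>j - v - 1\<close> modulo \<open>n\<close>, since
    \<open>r\<close> adds 1 to move residues from \<open>0..n-1\<close> to \<open>1..n\<close>. The
    summand \<open>n\<close> keeps the subtraction on naturals from truncating.\<close>
  define k where "k = j + n - v - 1"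
  define r where "r i = (i + k) mod n + 1" for i
  have "r i \<in> {1..n}" for i
    using assms by (auto simp: r_def Suc_le_eq)
  moreover have "inj_on r {1..n}"
  proof (rule linorder_inj_onI)
    fix x y assume xy: "x < y" "x \<in> {1..n}" "y \<in> {1..n}"
    show "r x \<noteq> r y"
    proof
      assume "r x = r y"
      \<comment> \<open>The difference is \<open>y - x\<close>, which lies strictly between 0 and
        \<open>n\<close>.\<close>
      then have "n dvd (y + k) - (x + k)"
        using xy by (subst mod_eq_dvd_iff_nat[symmetric]) (auto simp: r_def)
      then show False
        using xy by (auto dest: dvd_imp_le)
    qed
  qed auto
  ultimately have "bij_betw r {1..n} {1..n}"
    by (simp add: bij_betw_def endo_inj_surj image_subsetI)
  moreover have "r v = j"
  proof -
    have "v + k = (j - 1) + n"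
      using assms by (auto simp: k_def)
    then have "r v = (j - 1) mod n + 1"
      by (simp only: r_def mod_add_self2)
    then show ?thesis
      using assms by (auto simp: less_eq_Suc_le)
  qed
  moreover have "r ` e \<in> edges (cycle_graph n)" if "e \<in> edges (path_graph n)" for e
  proof -
    obtain i where e: "e = {i, i + 1}" "1 \<le> i" "i < n"
      using \<open>e \<in> edges (path_graph n)\<close> by (auto simp: path_graph_def)
    have "r i \<in> {1..n}" by fact
    \<comment> \<open>The wrap from \<open>n\<close> to 1 is exactly where the closing edge of the
      cycle is used.\<close>
    moreover have "r (i + 1) = (if r i = n then 1 else r i + 1)"
      by (auto simp: r_def mod_Suc)
    ultimately show ?thesis
      by (auto simp: e cycle_graph_def)
  qed
  ultimately show ?thesis
    using that by blast
qed

theorem theorem4p1: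
  fixes n :: nat and L :: "nat \<rightharpoonup> nat"
  assumes "n \<ge> 3"
    and "is_ordering 1 (path_graph n) L"
  shows "ordered_ramsey_number (path_graph n) L \<le> ramsey_number (cycle_graph n)"
proof -
  let ?m = "ramsey_number (cycle_graph n)"
  have verts: "verts (path_graph n) = {1..n}" "verts (cycle_graph n) = {1..n}"
    by (simp_all add: path_graph_def cycle_graph_def)
  obtain v where v: "dom L = {v}"
    using assms(2) by (auto simp: is_ordering_def card_1_singleton_iff)
  then obtain l where l: "L v = Some l" by blast
  have "v \<in> {1..n}" "l \<in> {1..n}"
    using assms(2) v l by (auto simp: is_ordering_def verts ran_def)
  \<comment> \<open>The closing edge \<open>{n, 1}\<close> is not a loop because
    \<open>n \<ge> 3\<close>.\<close>
  have "\<exists>u\<in>{1..n}. \<exists>w\<in>{1..n}. u \<noteq> w \<and> e = {u, w}" if "e \<in> edges (cycle_graph n)" for e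
  proof -
    consider i where "e = {i, i + 1}" "1 \<le> i" "i < n" | "e = {n, 1}"
      using \<open>e \<in> edges (cycle_graph n)\<close> by (auto simp: cycle_graph_def)
    then show ?thesis
    proof cases
      case 1
      then show ?thesis
        by (intro bexI[of _ i] bexI[of _ "i + 1"]) auto
    next
      case 2
      then show ?thesis
        using assms(1) by (intro bexI[of _ n] bexI[of _ 1]) auto
    qed
  qed
  then have "\<exists>m. \<forall>\<chi>. \<exists>c f. is_mono_copy m \<chi> c (cycle_graph n) f"
    by (intro ex_mono_copy) (auto simp: verts)
  then have cycle: "\<forall>\<chi>. \<exists>c f. is_mono_copy ?m \<chi> c (cycle_graph n) f"
    unfolding ramsey_number_def by (rule LeastI_ex)
  have "\<exists>c f. is_mono_copy ?m \<chi> c (path_graph n) f \<and> respects_ordering (path_graph n) L f" for \<chi>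
  proof -
    obtain c g where g: "inj_on g {1..n}" "g ` {1..n} \<subseteq> {1..?m}"
      "\<And>e. e \<in> edges (cycle_graph n) \<Longrightarrow> \<chi> (g ` e) = c"
      using cycle unfolding is_mono_copy_def verts by metis
    \<comment> \<open>The target \<open>x\<close> depends only on the vertex set of the copy of the
      cycle, so it can be fixed before the rotation is chosen.\<close>
    obtain x where x: "is_ith_smallest (g ` {1..n}) l x"
      using ex_is_ith_smallest[of "g ` {1..n}" l] \<open>l \<in> {1..n}\<close> by (metis card_atLeastAtMost card_image diff_Suc_1 finite_atLeastAtMost finite_imageI g(1))
    then obtain j where j: "j \<in> {1..n}" "x = g j"
      by (auto simp: is_ith_smallest_def)
    obtain r where r: "bij_betw r {1..n} {1..n}" "r v = j"
      "\<And>e. e \<in> edges (path_graph n) \<Longrightarrow> r ` e \<in> edges (cycle_graph n)"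
      using cycle_graph_rotation[OF j(1) \<open>v \<in> {1..n}\<close>] by blast
    \<comment> \<open>Rotating leaves the vertex set of the copy unchanged, and with it all
      ranks.\<close>
    have r_image: "(g \<circ> r) ` {1..n} = g ` {1..n}"
      using r(1) by (metis bij_betw_imp_surj_on image_comp)
    have "inj_on (g \<circ> r) {1..n}"
      using g(1) r(1) by (simp add: bij_betw_def comp_inj_on)
    moreover have "\<chi> ((g \<circ> r) ` e) = c" if "e \<in> edges (path_graph n)" for e
      using g(3)[OF r(3)[OF that]] by (simp add: image_comp)
    ultimately have "is_mono_copy ?m \<chi> c (path_graph n) (g \<circ> r)"
      using g(2) r_image by (simp add: is_mono_copy_def verts)
    moreover have "respects_ordering (path_graph n) L (g \<circ> r)"
      unfolding respects_ordering_def
    \<comment> \<open>At \<open>v\<close> the copy takes the value \<open>g j = x\<close>, whose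
      rank is \<open>l\<close>, forcing \<open>i = l\<close>; every other vertex is outside
      \<open>dom L\<close>.\<close>
    proof (intro ballI impI)
      fix i w
      assume "is_ith_smallest ((g \<circ> r) ` verts (path_graph n)) i ((g \<circ> r) w)"
      then show "L w = Some i \<or> L w = None"
        using x j r(2) l v unfolding verts r_image
        by (cases "w = v") (auto simp: is_ith_smallest_def)
    qed
    ultimately show ?thesis by blast
  qed
  then show ?thesis
    unfolding ordered_ramsey_number_def by (intro Least_le) blast
qed

end
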